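(* Let $E$ be a Banach lattice and $T:E\to E$ a $\sigma$-weak-uo continuous operator. If $T$ is uo-demi Dunford–Pettis, then for every integer $m\ge 1$ the power $T^m$ is uo-demi Dunford–Pettis.
   Context: All Banach lattices are real; "operator" means bounded linear map. A net $(x_\alpha)$ in a Banach lattice $E$ is uo-convergent (unbounded order convergent) to $x$, written $x_\alpha\xrightarrow{uo}x$, if $|x_\alpha-x|\wedge y$ converges in order to $0$ for every $y\in E^+$. An operator $T:E\to E$ on a Banach lattice $E$ is uo-demi Dunford–Pettis (unbounded order demi Dunford–Pettis) if for every weakly null sequence $(x_n)$ in $E$ such that $(x_n-T(x_n))$ is uo-convergent to $0$, one has $\|x_n\|\to0$. An operator $T:E\to E$ is $\sigma$-weak-uo continuous if $T(x_n)\xrightarrow{uo}0$ in $E$ for every weakly null sequence $(x_n)$ in $E$. *)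

theory Defs
  imports "HOL-Analysis.Analysis" "HOL-Library.Lattice_Algebras"
begin

(* The modulus is the lattice modulus: |x| = sup x (- x), by the class lattice_ab_group_add_abs. *)
class banach_lattice = banach + ordered_real_vector + lattice_ab_group_add_abs +
  assumes norm_mono_abs: "\<bar>x\<bar> \<le> \<bar>y\<bar> \<Longrightarrow> norm x \<le> norm y"

instance real :: banach_lattice
  by standard simp

(* D decreases to 0: D is nonempty, directed downwards, and has infimum 0 (no order completeness
   is assumed, so the infimum is spelled out).  Such a set, indexed by itself, is a decreasing net
   with infimum 0; conversely the range of every decreasing net with infimum 0 is such a set. *)
definition decreases_to_zero :: "'a::banach_lattice set \<Rightarrow> bool" where
  "decreases_to_zero D \<longleftrightarrow>
     D \<noteq> {} \<and>
     (\<forall>a\<in>D. \<forall>b\<in>D. \<exists>c\<in>D. c \<le> a \<and> c \<le> b) \<and>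
     (\<forall>d\<in>D. 0 \<le> d) \<and> (\<forall>l. (\<forall>d\<in>D. l \<le> d) \<longrightarrow> l \<le> 0)"

(* A net is represented by a function f together with the filter F of tails of its index set.
   The dominating net may have an index set different from that of f. *)
definition order_converges :: "('i \<Rightarrow> 'a::banach_lattice) \<Rightarrow> 'a \<Rightarrow> 'i filter \<Rightarrow> bool" where
  "order_converges f x F \<longleftrightarrow>
     (\<exists>D. decreases_to_zero D \<and> (\<forall>d\<in>D. \<forall>\<^sub>F i in F. \<bar>f i - x\<bar> \<le> d))"

definition uo_converges :: "('i \<Rightarrow> 'a::banach_lattice) \<Rightarrow> 'a \<Rightarrow> 'i filter \<Rightarrow> bool" where
  "uo_converges f x F \<longleftrightarrow> (\<forall>y\<ge>0. order_converges (\<lambda>i. inf \<bar>f i - x\<bar> y) 0 F)"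

definition weakly_null :: "(nat \<Rightarrow> 'a::real_normed_vector) \<Rightarrow> bool" where
  "weakly_null x \<longleftrightarrow> (\<forall>\<phi> :: 'a \<Rightarrow> real. bounded_linear \<phi> \<longrightarrow> (\<lambda>n. \<phi> (x n)) \<longlonglongrightarrow> 0)"

definition uo_demi_dunford_pettis :: "('a::banach_lattice \<Rightarrow> 'a) \<Rightarrow> bool" where
  "uo_demi_dunford_pettis T \<longleftrightarrow>
     bounded_linear T \<and>
     (\<forall>x. weakly_null x \<and> uo_converges (\<lambda>n. x n - T (x n)) 0 sequentially
        \<longrightarrow> (\<lambda>n. norm (x n)) \<longlonglongrightarrow> 0)"

definition sigma_weak_uo_continuous :: "('a::banach_lattice \<Rightarrow> 'a) \<Rightarrow> bool" where
  "sigma_weak_uo_continuous T \<longleftrightarrow>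
     bounded_linear T \<and>
     (\<forall>x. weakly_null x \<longrightarrow> uo_converges (\<lambda>n. T (x n)) 0 sequentially)"

end

theory Submission
  imports Defs
begin

text \<open>On weakly null sequences every power \<open>T\<^sup>m\<close> with \<open>m \<ge> 1\<close> produces uo-null sequences, because
  \<open>T\<^sup>m\<^sup>-\<^sup>1\<close> preserves weakly null sequences. Hence \<open>x - T x = (x - T\<^sup>m x) - (T x - T\<^sup>m x)\<close> is uo-null
  along such a sequence as soon as \<open>x - T\<^sup>m x\<close> is.\<close>

text \<open>The set of sums will dominate a sum of two order null nets. Its downward directedness is
  inherited in each summand separately; only the infimum needs an argument.\<close>

lemma decreases_to_zero_add:
  fixes D E :: "'a::banach_lattice set"
  assumes D: "decreases_to_zero D" and E: "decreases_to_zero E"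
  shows "decreases_to_zero {d + e |d e. d \<in> D \<and> e \<in> E}"
  unfolding decreases_to_zero_def
proof (intro conjI ballI allI impI)
  show "{d + e |d e. d \<in> D \<and> e \<in> E} \<noteq> {}"
    using D E by (auto simp: decreases_to_zero_def)
next
  fix a b assume "a \<in> {d + e |d e. d \<in> D \<and> e \<in> E}" "b \<in> {d + e |d e. d \<in> D \<and> e \<in> E}"
  then obtain d e d' e' where ab: "a = d + e" "b = d' + e'" "d \<in> D" "e \<in> E" "d' \<in> D" "e' \<in> E"
    by auto
  obtain d'' where "d'' \<in> D" "d'' \<le> d" "d'' \<le> d'"
    using D ab unfolding decreases_to_zero_def by blast
  moreover obtain e'' where "e'' \<in> E" "e'' \<le> e" "e'' \<le> e'"
    using E ab unfolding decreases_to_zero_def by blast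
  ultimately show "\<exists>c\<in>{d + e |d e. d \<in> D \<and> e \<in> E}. c \<le> a \<and> c \<le> b"
    using ab by (blast intro: add_mono)
next
  fix c assume "c \<in> {d + e |d e. d \<in> D \<and> e \<in> E}"
  then show "0 \<le> c"
    using D E by (auto simp: decreases_to_zero_def)
next
  fix l assume l: "\<forall>c\<in>{d + e |d e. d \<in> D \<and> e \<in> E}. l \<le> c"
  \<comment> \<open>The two infima are taken one after the other: for fixed \<open>d\<close>, the
    element \<open>l - d\<close> is a lower bound of \<open>E\<close>, so
    \<open>l - d \<le> 0\<close>. This makes \<open>l\<close> a lower bound of \<open>D\<close>,
    with no appeal to order completeness.\<close>
  have "l \<le> d" if "d \<in> D" for d
  proof -
    have "\<forall>e\<in>E. l - d \<le> e"
      using l that by (fastforce simp: diff_le_eq add.commute)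
    then have "l - d \<le> 0"
      using E unfolding decreases_to_zero_def by blast
    then show ?thesis
      by simp
  qed
  then show "l \<le> 0"
    using D unfolding decreases_to_zero_def by blast
qed

text \<open>If \<open>d\<close> and \<open>e\<close> eventually bound the two deviations, then
  \<open>d + e\<close> eventually bounds that of \<open>h\<close>. An inequality for
  \<open>h\<close> suffices, which suits truncations: these are subadditive but not
  additive.\<close>

lemma order_converges_dominated_add:
  assumes "order_converges f x F" and "order_converges g y F"
    and le: "\<And>i. \<bar>h i - z\<bar> \<le> \<bar>f i - x\<bar> + \<bar>g i - y\<bar>"
  shows "order_converges h z F"
proof -
  obtain D E where D: "decreases_to_zero D" "\<forall>d\<in>D. \<forall>\<^sub>F i in F. \<bar>f i - x\<bar> \<le> d"
    and E: "decreases_to_zero E" "\<forall>e\<in>E. \<forall>\<^sub>F i in F. \<bar>g i - y\<bar> \<le> e"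
    using assms(1,2) unfolding order_converges_def by blast
  have "\<forall>\<^sub>F i in F. \<bar>h i - z\<bar> \<le> d + e" if "d \<in> D" "e \<in> E" for d e
    using D(2)[rule_format, OF that(1)] E(2)[rule_format, OF that(2)]
    by eventually_elim (blast intro: order_trans[OF le] add_mono)
  then show ?thesis
    unfolding order_converges_def
    by (intro exI[of _ "{d + e |d e. d \<in> D \<and> e \<in> E}"])
      (use decreases_to_zero_add[OF D(1) E(1)] in blast)
qed

text \<open>Translations preserve infima, so the right-hand side expands to the infimum of
  \<open>a + b\<close>, \<open>a + y\<close>, \<open>y + b\<close> and \<open>y + y\<close>. The
  first is bounded below by \<open>inf (a + b) y\<close> trivially, the other three because they lie
  above \<open>y\<close>.\<close>

lemma inf_add_le:
  fixes a b y :: "'a::lattice_ab_group_add"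
  assumes "0 \<le> a" "0 \<le> b" "0 \<le> y"
  shows "inf (a + b) y \<le> inf a y + inf b y"
proof -
  have "y \<le> a + y" "y \<le> y + b" "y \<le> y + y"
    using assms by simp_all
  then have "inf (a + b) y \<le> inf (inf (a + b) (a + y)) (inf (y + b) (y + y))"
    by (intro le_infI inf_le1 le_infI2)
  then show ?thesis
    by (simp only: add_inf_distrib_left add_inf_distrib_right inf_assoc inf_commute inf_left_commute)
qed

text \<open>For each fixed \<open>u\<close>, the triangle inequality and subadditivity of truncation
  at \<open>u\<close> reduce the claim to order convergence of the two truncated nets.\<close>

lemma uo_converges_diff:
  fixes f g :: "'i \<Rightarrow> 'a::banach_lattice"
  assumes f: "uo_converges f x F" and g: "uo_converges g y F"
  shows "uo_converges (\<lambda>i. f i - g i) (x - y) F"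
  unfolding uo_converges_def
proof (intro allI impI)
  fix u :: 'a assume u: "0 \<le> u"
  have "inf \<bar>f i - g i - (x - y)\<bar> u \<le> inf \<bar>f i - x\<bar> u + inf \<bar>g i - y\<bar> u" for i
  proof -
    have "\<bar>f i - g i - (x - y)\<bar> \<le> \<bar>f i - x\<bar> + \<bar>g i - y\<bar>"
      using abs_triangle_ineq4[of "f i - x" "g i - y"] by (simp add: algebra_simps)
    then have "inf \<bar>f i - g i - (x - y)\<bar> u \<le> inf (\<bar>f i - x\<bar> + \<bar>g i - y\<bar>) u"
      by (rule inf_mono) simp
    also have "\<dots> \<le> inf \<bar>f i - x\<bar> u + inf \<bar>g i - y\<bar> u"
      using u by (intro inf_add_le) auto
    finally show ?thesis .
  qed
  \<comment> \<open>Truncated moduli are nonnegative, so the outer modulus and the subtracted limit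
    \<open>0\<close>, present in the definition of order convergence, change nothing.\<close>
  then have le: "\<bar>inf \<bar>f i - g i - (x - y)\<bar> u - 0\<bar>
      \<le> \<bar>inf \<bar>f i - x\<bar> u - 0\<bar> + \<bar>inf \<bar>g i - y\<bar> u - 0\<bar>" for i
    using u by (simp add: abs_of_nonneg)
  show "order_converges (\<lambda>i. inf \<bar>f i - g i - (x - y)\<bar> u) 0 F"
  proof (rule order_converges_dominated_add[OF _ _ le])
    show "order_converges (\<lambda>i. inf \<bar>f i - x\<bar> u) 0 F"
      using f u by (simp only: uo_converges_def)
    show "order_converges (\<lambda>i. inf \<bar>g i - y\<bar> u) 0 F"
      using g u by (simp only: uo_converges_def)
  qed
qed

lemma bounded_linear_funpow:
  fixes T :: "'a::real_normed_vector \<Rightarrow> 'a"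
  assumes "bounded_linear T"
  shows "bounded_linear (T ^^ n)"
proof (induction n)
  case 0
  show ?case
    using bounded_linear_ident by (simp add: id_def)
next
  case (Suc n)
  show ?case
    using bounded_linear_compose[OF assms Suc.IH] by (simp add: o_def)
qed

text \<open>A functional \<phi> on the target pulls back along \<open>S\<close> to a bounded
  functional on the source.\<close>

lemma weakly_null_bounded_linear:
  fixes S :: "'a::real_normed_vector \<Rightarrow> 'b::real_normed_vector"
  assumes "bounded_linear S" "weakly_null x"
  shows "weakly_null (\<lambda>n. S (x n))"
  unfolding weakly_null_def
proof (intro allI impI)
  fix \<phi> :: "'b \<Rightarrow> real" assume "bounded_linear \<phi>"
  then have "bounded_linear (\<lambda>v. \<phi> (S v))"
    using assms(1) by (rule bounded_linear_compose)
  then show "(\<lambda>n. \<phi> (S (x n))) \<longlonglongrightarrow> 0"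
    using assms(2) unfolding weakly_null_def by blast
qed

theorem proposition5p5:
  fixes T :: "'a::banach_lattice \<Rightarrow> 'a"
  assumes "bounded_linear T"
    and "sigma_weak_uo_continuous T"
    and "uo_demi_dunford_pettis T"
  shows "\<forall>m::nat. m \<ge> 1 \<longrightarrow> uo_demi_dunford_pettis (T ^^ m)"
proof (intro allI impI)
  fix m :: nat assume "m \<ge> 1"
  then obtain k where m: "m = Suc k"
    by (cases m) auto
  have uo: "uo_converges (\<lambda>n. T (x n)) 0 sequentially" if "weakly_null x" for x
    using assms(2) that by (simp add: sigma_weak_uo_continuous_def)
  have "(\<lambda>n. norm (x n)) \<longlonglongrightarrow> 0"
    if x: "weakly_null x" and lim: "uo_converges (\<lambda>n. x n - (T ^^ m) (x n)) 0 sequentially" for x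
  proof -
    \<comment> \<open>Since \<open>m = Suc k\<close>, the outermost factor \<open>T\<close> can be
      split off and acts on the weakly null sequence \<open>(T ^^ k) (x n)\<close>; for
      \<open>k = 0\<close> this is \<open>x\<close> itself.\<close>
    have "uo_converges (\<lambda>n. (T ^^ m) (x n)) 0 sequentially"
      using uo[OF weakly_null_bounded_linear[OF bounded_linear_funpow[OF assms(1)] x], of k]
      by (simp add: m)
    from uo_converges_diff[OF lim uo_converges_diff[OF uo[OF x] this]]
    have "uo_converges (\<lambda>n. x n - T (x n)) 0 sequentially"
      by simp
    with x assms(3) show ?thesis
      by (simp add: uo_demi_dunford_pettis_def)
  qed
  then show "uo_demi_dunford_pettis (T ^^ m)"
    using bounded_linear_funpow[OF assms(1)] by (simp add: uo_demi_dunford_pettis_def)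
qed

end
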